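(* Let $G$ be a finite group and let $\gamma=\{\gamma_j:\{1,2,\dots,k\}\to\mathbb{C}\}_{j=0,1,\dots,J}$ be an admissible kernel, that is, $$\sum_{j=1}^J|\gamma_j(r)|^2=1-|\gamma_0(r)|^2\ \ (r=1,\dots,k)\qquad\text{and}\qquad \beta_\gamma:=\min_{1\le r\le k}|\gamma_0(r)|^2>0.$$ Let $\alpha=1-\beta_\gamma<1$. For each $m\ge1$, $f\in L^2(G)$ and $g\in G$, $$\sum_{p\in\Lambda_J^m}\|S[p]L_gf-S[p]f\|^2\le\left(\max_{1\le r\le k}|\gamma_0(r)|^2\right)4\,\alpha^m\|f\|^2.$$ Moreover, the same inequality holds with $L_g$ replaced by $R_g$.
   Context: $G$ is a finite group (not necessarily abelian). $L^2(G)$ is the space of all functions $f:G\to\mathbb{C}$ with inner product $\langle f,g\rangle=\frac{1}{|G|}\sum_{x\in G}f(x)\overline{g(x)}$ and induced norm $\|f\|$. For $g\in G$ and $f\in L^2(G)$, $L_gf(x)=f(g^{-1}x)$ and $R_gf(x)=f(xg)$, $x\in G$. Convolution is $f*h(x)=\frac{1}{|G|}\sum_{y\in G}f(y)h(y^{-1}x)$. $\pi^1,\dots,\pi^k$ is a complete system of pairwise inequivalent irreducible unitary representations of $G$, $d_r$ is the degree of $\pi^r$ and $\chi^r(x)=\mathrm{Tr}(\pi^r(x))$. Fix an integer $J\ge1$. A kernel is a family of functions $\gamma=\{\gamma_j:\{1,\dots,k\}\to\mathbb{C}\}_{0\le j\le J}$; its $G$-wavelets are $\psi_j(x)=\sum_{r=1}^k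 d_r\gamma_j(r)\chi^r(x)$, $0\le j\le J$, and we write $\phi=\psi_0$. For $m\ge1$, $\Lambda_J^m=\{1,\dots,J\}^m$ is the set of paths of length $m$. For $f\in L^2(G)$, $U[j]f=|\psi_j*f|$ (pointwise modulus) for $1\le j\le J$, and $U[p]f=U[j_m]\cdots U[j_1]f$ for $p=(j_1,\dots,j_m)\in\Lambda_J^m$. Finally $S[p]f=\phi*U[p]f$. *)

theory Defs
  imports
    Complex_Main
    "HOL-Algebra.Group"
    "Jordan_Normal_Form.Schur_Decomposition"
begin

section \<open>Functions on a finite group\<close>

text \<open>Elements of $L^2(G)$ are total functions on the ambient type; every notion below
  depends only on their restriction to \<open>carrier G\<close>.\<close>

definition l2_inner :: "('a, 'b) monoid_scheme \<Rightarrow> ('a \<Rightarrow> complex) \<Rightarrow> ('a \<Rightarrow> complex) \<Rightarrow> complex" where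
  "l2_inner G f h = (\<Sum>x\<in>carrier G. f x * cnj (h x)) / of_nat (card (carrier G))"

definition l2_norm :: "('a, 'b) monoid_scheme \<Rightarrow> ('a \<Rightarrow> complex) \<Rightarrow> real" where
  "l2_norm G f = sqrt (Re (l2_inner G f f))"

definition left_translate :: "('a, 'b) monoid_scheme \<Rightarrow> 'a \<Rightarrow> ('a \<Rightarrow> complex) \<Rightarrow> 'a \<Rightarrow> complex" where
  "left_translate G g f x = f (inv\<^bsub>G\<^esub> g \<otimes>\<^bsub>G\<^esub> x)"

definition right_translate :: "('a, 'b) monoid_scheme \<Rightarrow> 'a \<Rightarrow> ('a \<Rightarrow> complex) \<Rightarrow> 'a \<Rightarrow> complex" where
  "right_translate G g f x = f (x \<otimes>\<^bsub>G\<^esub> g)"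

definition conv :: "('a, 'b) monoid_scheme \<Rightarrow> ('a \<Rightarrow> complex) \<Rightarrow> ('a \<Rightarrow> complex) \<Rightarrow> 'a \<Rightarrow> complex" where
  "conv G f h x =
     (\<Sum>y\<in>carrier G. f y * h (inv\<^bsub>G\<^esub> y \<otimes>\<^bsub>G\<^esub> x)) / of_nat (card (carrier G))"

section \<open>Irreducible unitary representations\<close>

definition unitary_group :: "nat \<Rightarrow> complex mat monoid" where
  "unitary_group n =
     \<lparr>carrier = {A \<in> carrier_mat n n.
                   inverts_mat A (mat_adjoint A) \<and> inverts_mat (mat_adjoint A) A},
      monoid.mult = (*), one = 1\<^sub>m n\<rparr>"

definition unitary_rep :: "('a, 'b) monoid_scheme \<Rightarrow> nat \<Rightarrow> ('a \<Rightarrow> complex mat) \<Rightarrow> bool" where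
  "unitary_rep G n \<rho> \<longleftrightarrow> \<rho> \<in> hom G (unitary_group n)"

definition invariant_subspace ::
    "('a, 'b) monoid_scheme \<Rightarrow> nat \<Rightarrow> ('a \<Rightarrow> complex mat) \<Rightarrow> complex vec set \<Rightarrow> bool" where
  "invariant_subspace G n \<rho> W \<longleftrightarrow>
     VectorSpace.subspace class_ring W (module_vec TYPE(complex) n) \<and>
     (\<forall>x\<in>carrier G. \<forall>w\<in>W. \<rho> x *\<^sub>v w \<in> W)"

definition irreducible_unitary_rep ::
    "('a, 'b) monoid_scheme \<Rightarrow> nat \<Rightarrow> ('a \<Rightarrow> complex mat) \<Rightarrow> bool" where
  "irreducible_unitary_rep G n \<rho> \<longleftrightarrow>
     unitary_rep G n \<rho> \<and> n > 0 \<and>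
     (\<forall>W. invariant_subspace G n \<rho> W \<longrightarrow> W = {0\<^sub>v n} \<or> W = carrier_vec n)"

text \<open>\<open>invertible_mat\<close> forces the intertwiner \<open>T\<close> to be square, so equivalent
  representations have the same degree.\<close>

definition equivalent_reps ::
    "('a, 'b) monoid_scheme \<Rightarrow> nat \<Rightarrow> ('a \<Rightarrow> complex mat) \<Rightarrow> nat \<Rightarrow> ('a \<Rightarrow> complex mat) \<Rightarrow> bool" where
  "equivalent_reps G n \<rho> m \<sigma> \<longleftrightarrow>
     (\<exists>T\<in>carrier_mat m n. invertible_mat T \<and> (\<forall>x\<in>carrier G. T * \<rho> x = \<sigma> x * T))"

definition complete_irrep_system ::
    "('a, 'b) monoid_scheme \<Rightarrow> nat \<Rightarrow> (nat \<Rightarrow> nat) \<Rightarrow> (nat \<Rightarrow> 'a \<Rightarrow> complex mat) \<Rightarrow> bool" where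
  "complete_irrep_system G k d \<pi> \<longleftrightarrow>
     (\<forall>r\<in>{1..k}. irreducible_unitary_rep G (d r) (\<pi> r)) \<and>
     (\<forall>r\<in>{1..k}. \<forall>s\<in>{1..k}. r \<noteq> s \<longrightarrow> \<not> equivalent_reps G (d r) (\<pi> r) (d s) (\<pi> s)) \<and>
     (\<forall>n \<rho>. irreducible_unitary_rep G n \<rho> \<longrightarrow>
        (\<exists>r\<in>{1..k}. equivalent_reps G n \<rho> (d r) (\<pi> r)))"

definition rep_character :: "('a \<Rightarrow> complex mat) \<Rightarrow> 'a \<Rightarrow> complex" where
  "rep_character \<rho> x = (\<Sum>i<dim_row (\<rho> x). \<rho> x $$ (i, i))"

section \<open>Kernels, wavelets and the scattering transform\<close>

text \<open>A kernel is \<open>\<gamma> j r\<close> with \<open>0 \<le> j \<le> J\<close> and \<open>1 \<le> r \<le> k\<close>; its values at other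
  indices are never used.\<close>

definition wavelet ::
    "nat \<Rightarrow> (nat \<Rightarrow> nat) \<Rightarrow> (nat \<Rightarrow> 'a \<Rightarrow> complex mat) \<Rightarrow> (nat \<Rightarrow> nat \<Rightarrow> complex) \<Rightarrow>
     nat \<Rightarrow> 'a \<Rightarrow> complex" where
  "wavelet k d \<pi> \<gamma> j x = (\<Sum>r=1..k. of_nat (d r) * \<gamma> j r * rep_character (\<pi> r) x)"

definition kernel_beta :: "nat \<Rightarrow> (nat \<Rightarrow> nat \<Rightarrow> complex) \<Rightarrow> real" where
  "kernel_beta k \<gamma> = Min ((\<lambda>r. (cmod (\<gamma> 0 r))\<^sup>2) ` {1..k})"

definition admissible_kernel :: "nat \<Rightarrow> nat \<Rightarrow> (nat \<Rightarrow> nat \<Rightarrow> complex) \<Rightarrow> bool" where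
  "admissible_kernel k J \<gamma> \<longleftrightarrow>
     (\<forall>r\<in>{1..k}. (\<Sum>j=1..J. (cmod (\<gamma> j r))\<^sup>2) = 1 - (cmod (\<gamma> 0 r))\<^sup>2) \<and>
     kernel_beta k \<gamma> > 0"

definition paths :: "nat \<Rightarrow> nat \<Rightarrow> nat list set" where
  "paths J m = {p. length p = m \<and> set p \<subseteq> {1..J}}"

definition scatter_step ::
    "('a, 'b) monoid_scheme \<Rightarrow> (nat \<Rightarrow> 'a \<Rightarrow> complex) \<Rightarrow> nat \<Rightarrow> ('a \<Rightarrow> complex) \<Rightarrow> 'a \<Rightarrow> complex" where
  "scatter_step G \<psi> j f x = complex_of_real (cmod (conv G (\<psi> j) f x))"

text \<open>\<open>fold\<close> applies the operator of the first entry of the path first, that is,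
  $U[p] = U[j_m] \cdots U[j_1]$ for $p = (j_1, \dots, j_m)$.\<close>

definition scatter_propagator ::
    "('a, 'b) monoid_scheme \<Rightarrow> (nat \<Rightarrow> 'a \<Rightarrow> complex) \<Rightarrow> nat list \<Rightarrow> ('a \<Rightarrow> complex) \<Rightarrow> 'a \<Rightarrow> complex" where
  "scatter_propagator G \<psi> p f = fold (scatter_step G \<psi>) p f"

definition scattering ::
    "('a, 'b) monoid_scheme \<Rightarrow> (nat \<Rightarrow> 'a \<Rightarrow> complex) \<Rightarrow> nat list \<Rightarrow> ('a \<Rightarrow> complex) \<Rightarrow> 'a \<Rightarrow> complex" where
  "scattering G \<psi> p f = conv G (\<psi> 0) (scatter_propagator G \<psi> p f)"

end

theory Submission
  imports Defs "Jordan_Normal_Form.Spectral_Radius"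
begin

text \<open>
  Put $e_r = d_r \chi^r$. Schur's lemma gives the orthogonality relations of the matrix
  coefficients of the $\pi^r$, and these say that $e_r * e_s = \delta_{rs} e_r$
  (lemma \<open>characters_orthogonal_idempotents\<close>). Since also $e_r(x^{-1}) = \overline{e_r(x)}$,
  the operators $P_r f = e_r * f$ are mutually orthogonal self-adjoint projections. The wavelets
  are $\psi_j = \sum_r \gamma_j(r) e_r$, so
  $\|\psi_j * f\|^2 = \sum_r |\gamma_j(r)|^2 \|P_r f\|^2$ (lemma \<open>norm_conv_combination\<close>).

  With Bessel's inequality $\sum_r \|P_r f\|^2 \le \|f\|^2$ and admissibility this yields
  $\sum_{j \ge 1} \|\psi_j * f\|^2 \le \alpha \|f\|^2$ and
  $\|\phi * f\|^2 \le \max_r |\gamma_0(r)|^2 \|f\|^2$. As the modulus preserves the norm,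
  induction on the path length gives $\sum_p \|U[p] f\|^2 \le \alpha^m \|f\|^2$
  (lemma \<open>propagator_energy_decay\<close>).

  Finally $S[p] h - S[p] f = \phi * (U[p] h - U[p] f)$ and
  $\|a - b\|^2 \le 2 \|a\|^2 + 2 \|b\|^2$, so the sum over $p$ of $\|S[p] h - S[p] f\|^2$ is at
  most $\max_r |\gamma_0(r)|^2 \cdot 4 \alpha^m \|f\|^2$ whenever $\|h\| = \|f\|$. Both
  translations are isometries, which is the only property of them that enters.
\<close>

section \<open>Adjoints and unitary representations\<close>

lemma mat_adjoint_index:
  fixes A :: "complex mat"
  assumes "A \<in> carrier_mat n m" "i < m" "j < n"
  shows "mat_adjoint A $$ (i, j) = cnj (A $$ (j, i))"
  using assms unfolding mat_adjoint_def by (simp add: mat_of_rows_def)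

lemma mat_adjoint_carrier:
  fixes A :: "complex mat"
  assumes "A \<in> carrier_mat n m"
  shows "mat_adjoint A \<in> carrier_mat m n"
  using assms unfolding mat_adjoint_def by (auto simp: mat_of_rows_def)

lemma mat_adjoint_mult:
  fixes A B :: "complex mat"
  assumes A: "A \<in> carrier_mat n m" and B: "B \<in> carrier_mat m l"
  shows "mat_adjoint (A * B) = mat_adjoint B * mat_adjoint A"
proof (rule eq_matI)
  note AB = mult_carrier_mat[OF A B]
  note cA = mat_adjoint_carrier[OF A] and cB = mat_adjoint_carrier[OF B]
    and cAB = mat_adjoint_carrier[OF AB]
  show "dim_row (mat_adjoint (A * B)) = dim_row (mat_adjoint B * mat_adjoint A)"
    and "dim_col (mat_adjoint (A * B)) = dim_col (mat_adjoint B * mat_adjoint A)"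
    using cA cB cAB by auto
  fix i j assume "i < dim_row (mat_adjoint B * mat_adjoint A)"
    "j < dim_col (mat_adjoint B * mat_adjoint A)"
  then have i: "i < l" and j: "j < n" using cA cB by auto
  have "mat_adjoint (A * B) $$ (i, j) = cnj (\<Sum>k<m. A $$ (j, k) * B $$ (k, i))"
    using A B i j by (simp add: mat_adjoint_index[OF AB i j] scalar_prod_def atLeast0LessThan)
  also have "\<dots> = (\<Sum>k<m. mat_adjoint B $$ (i, k) * mat_adjoint A $$ (k, j))"
    using i j by (simp add: mat_adjoint_index[OF A] mat_adjoint_index[OF B] mult.commute)
  also have "\<dots> = (mat_adjoint B * mat_adjoint A) $$ (i, j)"
    using cA cB i j by (simp add: scalar_prod_def atLeast0LessThan)
  finally show "mat_adjoint (A * B) $$ (i, j) = (mat_adjoint B * mat_adjoint A) $$ (i, j)" .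
qed

locale finite_group = group G for G (structure) +
  assumes finite_carrier: "finite (carrier G)"
begin

lemma sum_left_mult:
  assumes "g \<in> carrier G"
  shows "(\<Sum>x\<in>carrier G. F (g \<otimes> x)) = (\<Sum>x\<in>carrier G. F x :: complex)"
  by (rule sum.reindex_bij_witness[of _ "\<lambda>x. inv g \<otimes> x" "\<lambda>x. g \<otimes> x"])
    (use assms in \<open>auto simp: m_assoc[symmetric]\<close>)

lemma card_carrier_pos: "card (carrier G) > 0"
  using finite_carrier one_closed by (auto simp: card_gt_0_iff)

lemma unitary_rep_carrier:
  "unitary_rep G n \<rho> \<Longrightarrow> x \<in> carrier G \<Longrightarrow> \<rho> x \<in> carrier_mat n n"
  by (auto simp: unitary_rep_def unitary_group_def hom_def Pi_iff)

lemma unitary_rep_mult: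
  "unitary_rep G n \<rho> \<Longrightarrow> x \<in> carrier G \<Longrightarrow> y \<in> carrier G \<Longrightarrow> \<rho> (x \<otimes> y) = \<rho> x * \<rho> y"
  by (auto simp: unitary_rep_def unitary_group_def hom_def)

lemma unitary_rep_adjoint:
  assumes "unitary_rep G n \<rho>" "x \<in> carrier G"
  shows "\<rho> x * mat_adjoint (\<rho> x) = 1\<^sub>m n" "mat_adjoint (\<rho> x) * \<rho> x = 1\<^sub>m n"
proof -
  have "\<rho> x \<in> carrier (unitary_group n)"
    using assms by (auto simp: unitary_rep_def hom_def)
  then have "\<rho> x \<in> carrier_mat n n" "inverts_mat (\<rho> x) (mat_adjoint (\<rho> x))"
    "inverts_mat (mat_adjoint (\<rho> x)) (\<rho> x)"
    by (auto simp: unitary_group_def)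
  then show "\<rho> x * mat_adjoint (\<rho> x) = 1\<^sub>m n" "mat_adjoint (\<rho> x) * \<rho> x = 1\<^sub>m n"
    using mat_adjoint_carrier[of "\<rho> x" n n] by (auto simp: inverts_mat_def)
qed

lemma unitary_rep_one:
  assumes \<rho>: "unitary_rep G n \<rho>"
  shows "\<rho> \<one> = 1\<^sub>m n"
proof -
  note c = unitary_rep_carrier[OF \<rho> one_closed]
  note u = unitary_rep_adjoint[OF \<rho> one_closed]
  have "\<rho> \<one> = (\<rho> \<one> * \<rho> \<one>) * mat_adjoint (\<rho> \<one>)"
    using c u mat_adjoint_carrier[OF c] by (simp add: assoc_mult_mat[of _ n n _ n _ n])
  also have "\<rho> \<one> * \<rho> \<one> = \<rho> \<one>"
    using unitary_rep_mult[OF \<rho> one_closed one_closed] by simp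
  finally show ?thesis using u by simp
qed

lemma unitary_rep_inv:
  assumes \<rho>: "unitary_rep G n \<rho>" and x: "x \<in> carrier G"
  shows "\<rho> (inv x) = mat_adjoint (\<rho> x)"
proof -
  note c = unitary_rep_carrier[OF \<rho> x]
  note ci = unitary_rep_carrier[OF \<rho> inv_closed[OF x]]
  note u = unitary_rep_adjoint[OF \<rho> x]
  have "\<rho> (inv x) = (\<rho> (inv x) * \<rho> x) * mat_adjoint (\<rho> x)"
    using c ci u mat_adjoint_carrier[OF c] by (simp add: assoc_mult_mat[of _ n n _ n _ n])
  also have "\<rho> (inv x) * \<rho> x = 1\<^sub>m n"
    using unitary_rep_mult[OF \<rho> inv_closed[OF x] x] x unitary_rep_one[OF \<rho>] by simp
  finally show ?thesis using mat_adjoint_carrier[OF c] by simp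
qed

lemma unitary_rep_inv_index:
  assumes "unitary_rep G n \<rho>" "x \<in> carrier G" "i < n" "j < n"
  shows "\<rho> (inv x) $$ (i, j) = cnj (\<rho> x $$ (j, i))"
  using assms by (simp add: unitary_rep_inv mat_adjoint_index[OF unitary_rep_carrier])

lemma unitary_rep_mult_index:
  assumes "unitary_rep G n \<rho>" "x \<in> carrier G" "y \<in> carrier G" "i < n" "j < n"
  shows "\<rho> (x \<otimes> y) $$ (i, j) = (\<Sum>l<n. \<rho> x $$ (i, l) * \<rho> y $$ (l, j))"
  using assms unitary_rep_carrier[of n \<rho> x] unitary_rep_carrier[of n \<rho> y]
  by (simp add: unitary_rep_mult scalar_prod_def atLeast0LessThan)

lemma character_eq_sum:
  assumes "unitary_rep G n \<rho>" "x \<in> carrier G"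
  shows "rep_character \<rho> x = (\<Sum>i<n. \<rho> x $$ (i, i))"
  using unitary_rep_carrier[OF assms] by (simp add: rep_character_def)

lemma character_inv:
  assumes "unitary_rep G n \<rho>" "x \<in> carrier G"
  shows "rep_character \<rho> (inv x) = cnj (rep_character \<rho> x)"
  using assms by (simp add: character_eq_sum unitary_rep_inv_index)

section \<open>Schur's lemma and orthogonality of matrix coefficients\<close>

text \<open>An eigenspace of \<open>T\<close> is a nonzero invariant subspace, hence everything.\<close>

lemma schur_commutant:
  assumes irr: "irreducible_unitary_rep G n \<rho>" and T: "T \<in> carrier_mat n n"
    and comm: "\<And>x. x \<in> carrier G \<Longrightarrow> T * \<rho> x = \<rho> x * T"
  shows "\<exists>c. T = c \<cdot>\<^sub>m 1\<^sub>m n"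
proof -
  have \<rho>: "unitary_rep G n \<rho>" and n: "n > 0"
    using irr by (auto simp: irreducible_unitary_rep_def)
  from spectrum_non_empty[OF T n] obtain c where "eigenvalue T c"
    by (auto simp: spectrum_def)
  then obtain v where v: "v \<in> carrier_vec n" "v \<noteq> 0\<^sub>v n" "T *\<^sub>v v = c \<cdot>\<^sub>v v"
    using T by (auto simp: eigenvalue_def eigenvector_def)
  define W where "W = {v \<in> carrier_vec n. T *\<^sub>v v = c \<cdot>\<^sub>v v}"
  interpret V: vec_space "TYPE(complex)" n .
  have "VectorSpace.subspace class_ring W (module_vec TYPE(complex) n)"
  proof (rule VectorSpace.subspace.intro)
    show "vectorspace class_ring (module_vec TYPE(complex) n)" by (rule V.vectorspace_axioms)
    show "submodule class_ring W (module_vec TYPE(complex) n)"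
    proof (rule submodule.intro)
      show "Module.module class_ring (module_vec TYPE(complex) n)" by (rule V.module_axioms)
      show "W \<subseteq> carrier (module_vec TYPE(complex) n)" by (auto simp: W_def module_vec_def)
      show "v \<oplus>\<^bsub>module_vec TYPE(complex) n\<^esub> w \<in> W" if "v \<in> W" "w \<in> W" for v w
        using that T by (auto simp: W_def module_vec_def mult_add_distrib_mat_vec smult_add_distrib_vec)
      show "\<zero>\<^bsub>module_vec TYPE(complex) n\<^esub> \<in> W"
        using T by (auto simp: W_def module_vec_def)
      show "a \<odot>\<^bsub>module_vec TYPE(complex) n\<^esub> w \<in> W" if "w \<in> W" for a w
        using that T by (auto simp: W_def module_vec_def mult_mat_vec smult_smult_assoc mult.commute)
    qed
  qed
  moreover have "\<rho> x *\<^sub>v w \<in> W" if x: "x \<in> carrier G" and w: "w \<in> W" for x w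
  proof -
    note c = unitary_rep_carrier[OF \<rho> x]
    have w': "w \<in> carrier_vec n" "T *\<^sub>v w = c \<cdot>\<^sub>v w" using w by (auto simp: W_def)
    have "T *\<^sub>v (\<rho> x *\<^sub>v w) = (T * \<rho> x) *\<^sub>v w"
      using assoc_mult_mat_vec[OF T c w'(1)] by simp
    also have "\<dots> = \<rho> x *\<^sub>v (T *\<^sub>v w)"
      unfolding comm[OF x] using assoc_mult_mat_vec[OF c T w'(1)] by simp
    also have "\<dots> = c \<cdot>\<^sub>v (\<rho> x *\<^sub>v w)"
      using mult_mat_vec[OF c w'(1)] w'(2) by simp
    finally show ?thesis using c w'(1) by (auto simp: W_def)
  qed
  ultimately have "invariant_subspace G n \<rho> W" by (auto simp: invariant_subspace_def)
  then have "W = {0\<^sub>v n} \<or> W = carrier_vec n"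
    using irr by (auto simp: irreducible_unitary_rep_def)
  moreover have "v \<in> W" using v by (auto simp: W_def)
  ultimately have W: "W = carrier_vec n" using v(2) by auto
  have "T = c \<cdot>\<^sub>m 1\<^sub>m n"
  proof (rule eq_matI)
    fix i j assume "i < dim_row (c \<cdot>\<^sub>m 1\<^sub>m n)" "j < dim_col (c \<cdot>\<^sub>m 1\<^sub>m n)"
    then have ij: "i < n" "j < n" by auto
    have "unit_vec n j \<in> W" unfolding W by simp
    then have "T *\<^sub>v unit_vec n j = c \<cdot>\<^sub>v unit_vec n j" by (auto simp: W_def)
    then have "(T *\<^sub>v unit_vec n j) $ i = (c \<cdot>\<^sub>v unit_vec n j) $ i" by simp
    moreover have "(T *\<^sub>v unit_vec n j) $ i = T $$ (i, j)"
      using T ij by simp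
    ultimately show "T $$ (i, j) = (c \<cdot>\<^sub>m 1\<^sub>m n) $$ (i, j)"
      using ij by simp
  qed (use T in auto)
  then show ?thesis by blast
qed

lemma adjoint_intertwines:
  assumes \<rho>: "unitary_rep G n \<rho>" and \<sigma>: "unitary_rep G m \<sigma>" and T: "T \<in> carrier_mat m n"
    and tw: "\<And>x. x \<in> carrier G \<Longrightarrow> T * \<rho> x = \<sigma> x * T" and x: "x \<in> carrier G"
  shows "mat_adjoint T * \<sigma> x = \<rho> x * mat_adjoint T"
proof -
  have ix: "inv x \<in> carrier G" using x by simp
  have "mat_adjoint (T * \<rho> (inv x)) = mat_adjoint (\<sigma> (inv x) * T)"
    using tw[OF ix] by simp
  then have "mat_adjoint (\<rho> (inv x)) * mat_adjoint T = mat_adjoint T * mat_adjoint (\<sigma> (inv x))"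
    using mat_adjoint_mult[OF T unitary_rep_carrier[OF \<rho> ix]]
      mat_adjoint_mult[OF unitary_rep_carrier[OF \<sigma> ix] T] by simp
  then show ?thesis
    using unitary_rep_inv[OF \<rho> ix] unitary_rep_inv[OF \<sigma> ix] x by simp
qed

text \<open>For an intertwiner \<open>T\<close>, both products of \<open>T\<close> with its adjoint are scalar by
  \<open>schur_commutant\<close>. If \<open>T\<close> is nonzero, the two scalars are equal and nonzero, comparing
  traces shows that \<open>T\<close> is square, and a multiple of the adjoint inverts it.\<close>

lemma schur_inequivalent:
  assumes irr: "irreducible_unitary_rep G n \<rho>" and irr': "irreducible_unitary_rep G m \<sigma>"
    and ne: "\<not> equivalent_reps G n \<rho> m \<sigma>" and T: "T \<in> carrier_mat m n"
    and tw: "\<And>x. x \<in> carrier G \<Longrightarrow> T * \<rho> x = \<sigma> x * T"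
  shows "T = 0\<^sub>m m n"
proof (rule ccontr)
  assume T0: "T \<noteq> 0\<^sub>m m n"
  have \<rho>: "unitary_rep G n \<rho>" and n: "n > 0" using irr by (auto simp: irreducible_unitary_rep_def)
  have \<sigma>: "unitary_rep G m \<sigma>" and m: "m > 0" using irr' by (auto simp: irreducible_unitary_rep_def)
  let ?S = "mat_adjoint T"
  note S = mat_adjoint_carrier[OF T]
  have tw': "?S * \<sigma> x = \<rho> x * ?S" if "x \<in> carrier G" for x
    by (rule adjoint_intertwines[OF \<rho> \<sigma> T _ that]) (rule tw)
  have "(?S * T) * \<rho> x = \<rho> x * (?S * T)" if x: "x \<in> carrier G" for x
  proof -
    note c = unitary_rep_carrier[OF \<rho> x] and c' = unitary_rep_carrier[OF \<sigma> x]
    have "(?S * T) * \<rho> x = ?S * (\<sigma> x * T)" using assoc_mult_mat[OF S T c] tw[OF x] by simp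
    also have "\<dots> = (\<rho> x * ?S) * T" using assoc_mult_mat[OF S c' T] tw'[OF x] by simp
    also have "\<dots> = \<rho> x * (?S * T)" by (rule assoc_mult_mat[OF c S T])
    finally show ?thesis .
  qed
  from schur_commutant[OF irr mult_carrier_mat[OF S T] this]
  obtain c where c: "?S * T = c \<cdot>\<^sub>m 1\<^sub>m n" by blast
  have "(T * ?S) * \<sigma> x = \<sigma> x * (T * ?S)" if x: "x \<in> carrier G" for x
  proof -
    note c = unitary_rep_carrier[OF \<rho> x] and c' = unitary_rep_carrier[OF \<sigma> x]
    have "(T * ?S) * \<sigma> x = T * (\<rho> x * ?S)" using assoc_mult_mat[OF T S c'] tw'[OF x] by simp
    also have "\<dots> = (\<sigma> x * T) * ?S" using assoc_mult_mat[OF T c S] tw[OF x] by simp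
    also have "\<dots> = \<sigma> x * (T * ?S)" by (rule assoc_mult_mat[OF c' T S])
    finally show ?thesis .
  qed
  from schur_commutant[OF irr' mult_carrier_mat[OF T S] this]
  obtain e where e: "T * ?S = e \<cdot>\<^sub>m 1\<^sub>m m" by blast
  obtain i j where ij: "i < m" "j < n" "T $$ (i, j) \<noteq> 0"
    using T0 T by (auto simp: mat_eq_iff)
  have "c \<cdot>\<^sub>m T = T * (?S * T)" unfolding c using T by (simp add: mult_smult_distrib[OF T one_carrier_mat])
  also have "\<dots> = (T * ?S) * T" using assoc_mult_mat[OF T S T] by simp
  also have "\<dots> = e \<cdot>\<^sub>m T" unfolding e using T by (simp add: mult_smult_assoc_mat[OF one_carrier_mat T])
  finally have "c \<cdot>\<^sub>m T = e \<cdot>\<^sub>m T" .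
  then have "(c \<cdot>\<^sub>m T) $$ (i, j) = (e \<cdot>\<^sub>m T) $$ (i, j)" by simp
  then have ce: "c = e" using T ij by simp
  \<comment> \<open>A diagonal entry of \<open>?S * T\<close> is the squared length of a column of \<open>T\<close>, one of \<open>T * ?S\<close>
    that of a row.\<close>
  have cval: "c = of_real (\<Sum>k<m. (cmod (T $$ (k, l)))\<^sup>2)" if "l < n" for l
  proof -
    have "c = (?S * T) $$ (l, l)" unfolding c using that by simp
    also have "\<dots> = (\<Sum>k<m. cnj (T $$ (k, l)) * T $$ (k, l))"
      using S T that by (simp add: scalar_prod_def atLeast0LessThan mat_adjoint_index[OF T])
    finally show ?thesis by (simp add: complex_norm_square[symmetric] mult.commute[of "cnj _"] del: of_real_power)
  qed
  have eval: "e = of_real (\<Sum>l<n. (cmod (T $$ (k, l)))\<^sup>2)" if "k < m" for k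
  proof -
    have "e = (T * ?S) $$ (k, k)" unfolding e using that by simp
    also have "\<dots> = (\<Sum>l<n. T $$ (k, l) * cnj (T $$ (k, l)))"
      using S T that by (simp add: scalar_prod_def atLeast0LessThan mat_adjoint_index[OF T])
    finally show ?thesis by (simp add: complex_norm_square[symmetric] del: of_real_power)
  qed
  have "(\<Sum>k<m. (cmod (T $$ (k, j)))\<^sup>2) \<ge> (cmod (T $$ (i, j)))\<^sup>2"
    by (rule member_le_sum) (use ij in auto)
  moreover have "(cmod (T $$ (i, j)))\<^sup>2 > 0" using ij by simp
  ultimately have "(\<Sum>k<m. (cmod (T $$ (k, j)))\<^sup>2) > 0" by linarith
  then have c0: "c \<noteq> 0" using cval[OF ij(2)] by (metis of_real_eq_0_iff less_irrefl)
  \<comment> \<open>Both traces equal the sum of the squared moduli of all entries of \<open>T\<close>.\<close>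
  have "of_nat n * c = (\<Sum>l<n. c)" by simp
  also have "\<dots> = (\<Sum>l<n. of_real (\<Sum>k<m. (cmod (T $$ (k, l)))\<^sup>2))"
    by (intro sum.cong refl cval) simp
  also have "\<dots> = (\<Sum>k<m. of_real (\<Sum>l<n. (cmod (T $$ (k, l)))\<^sup>2))"
    unfolding of_real_sum by (rule sum.swap)
  also have "\<dots> = (\<Sum>k<m. e)"
    by (intro sum.cong refl eval[symmetric]) simp
  also have "\<dots> = of_nat m * e" by simp
  finally have nm: "n = m" using ce c0 by simp
  have "inverts_mat T ((1 / c) \<cdot>\<^sub>m ?S)" "inverts_mat ((1 / c) \<cdot>\<^sub>m ?S) T"
    using T S c e ce c0 nm
    by (auto simp: inverts_mat_def mult_smult_distrib[OF T S] mult_smult_assoc_mat[OF S T])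
  then have "invertible_mat T" using T nm by (auto simp: invertible_mat_def)
  then have "equivalent_reps G n \<rho> m \<sigma>" using T tw by (auto simp: equivalent_reps_def)
  then show False using ne by simp
qed

text \<open>The \<open>m\<close> by \<open>n\<close> matrix \<open>\<Sum>x. \<sigma> x * E * \<rho> (inv x)\<close>, where \<open>E\<close> is the matrix unit with
  its nonzero entry at position \<open>(a, b)\<close>, written out in entries.\<close>

definition averaged_unit ::
    "nat \<Rightarrow> ('a \<Rightarrow> complex mat) \<Rightarrow> nat \<Rightarrow> ('a \<Rightarrow> complex mat) \<Rightarrow> nat \<Rightarrow> nat \<Rightarrow> complex mat" where
  "averaged_unit m \<sigma> n \<rho> a b =
     mat m n (\<lambda>(i, j). \<Sum>x\<in>carrier G. \<sigma> x $$ (i, a) * \<rho> (inv x) $$ (b, j))"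

lemma averaged_unit_intertwines:
  assumes \<rho>: "unitary_rep G n \<rho>" and \<sigma>: "unitary_rep G m \<sigma>" and a: "a < m" and b: "b < n"
    and y: "y \<in> carrier G"
  shows "averaged_unit m \<sigma> n \<rho> a b * \<rho> y = \<sigma> y * averaged_unit m \<sigma> n \<rho> a b"
proof (rule eq_matI)
  let ?T = "averaged_unit m \<sigma> n \<rho> a b"
  have T: "?T \<in> carrier_mat m n" by (simp add: averaged_unit_def)
  note c = unitary_rep_carrier[OF \<rho> y] and c' = unitary_rep_carrier[OF \<sigma> y]
  show "dim_row (?T * \<rho> y) = dim_row (\<sigma> y * ?T)" "dim_col (?T * \<rho> y) = dim_col (\<sigma> y * ?T)"
    using T c c' by auto
  fix i j assume "i < dim_row (\<sigma> y * ?T)" "j < dim_col (\<sigma> y * ?T)"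
  then have i: "i < m" and j: "j < n" using T c' by auto
  have "(?T * \<rho> y) $$ (i, j) = (\<Sum>l<n. ?T $$ (i, l) * \<rho> y $$ (l, j))"
    using T c i j by (simp add: scalar_prod_def atLeast0LessThan)
  also have "\<dots> = (\<Sum>l<n. \<Sum>x\<in>carrier G. \<sigma> x $$ (i, a) * \<rho> (inv x) $$ (b, l) * \<rho> y $$ (l, j))"
    using i by (simp add: averaged_unit_def sum_distrib_right)
  also have "\<dots> = (\<Sum>x\<in>carrier G. \<sigma> x $$ (i, a) * (\<Sum>l<n. \<rho> (inv x) $$ (b, l) * \<rho> y $$ (l, j)))"
    by (subst sum.swap) (simp add: sum_distrib_left mult.assoc)
  also have "\<dots> = (\<Sum>x\<in>carrier G. \<sigma> x $$ (i, a) * \<rho> (inv x \<otimes> y) $$ (b, j))"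
    using unitary_rep_mult_index[OF \<rho> _ y b j] by simp
  also have "\<dots> = (\<Sum>z\<in>carrier G. \<sigma> (y \<otimes> z) $$ (i, a) * \<rho> (inv (y \<otimes> z) \<otimes> y) $$ (b, j))"
    by (rule sum_left_mult[OF y, symmetric])
  also have "\<dots> = (\<Sum>z\<in>carrier G. (\<Sum>l<m. \<sigma> y $$ (i, l) * \<sigma> z $$ (l, a)) * \<rho> (inv z) $$ (b, j))"
    using unitary_rep_mult_index[OF \<sigma> y _ i a] y
    by (intro sum.cong) (simp_all add: inv_mult_group m_assoc)
  also have "\<dots> = (\<Sum>l<m. \<Sum>z\<in>carrier G. \<sigma> y $$ (i, l) * (\<sigma> z $$ (l, a) * \<rho> (inv z) $$ (b, j)))"
    by (subst sum.swap) (simp add: sum_distrib_right mult.assoc)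
  also have "\<dots> = (\<Sum>l<m. \<sigma> y $$ (i, l) * ?T $$ (l, j))"
    using j by (simp add: averaged_unit_def sum_distrib_left)
  also have "\<dots> = (\<sigma> y * ?T) $$ (i, j)"
    using T c' i j by (simp add: scalar_prod_def atLeast0LessThan)
  finally show "(?T * \<rho> y) $$ (i, j) = (\<sigma> y * ?T) $$ (i, j)" .
qed

lemma coefficients_orthogonal_inequivalent:
  assumes irr: "irreducible_unitary_rep G n \<rho>" and irr': "irreducible_unitary_rep G m \<sigma>"
    and ne: "\<not> equivalent_reps G n \<rho> m \<sigma>"
    and "i < m" "a < m" "b < n" "j < n"
  shows "(\<Sum>x\<in>carrier G. \<sigma> x $$ (i, a) * \<rho> (inv x) $$ (b, j)) = 0"
proof -
  have \<rho>: "unitary_rep G n \<rho>" and \<sigma>: "unitary_rep G m \<sigma>"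
    using irr irr' by (auto simp: irreducible_unitary_rep_def)
  have "averaged_unit m \<sigma> n \<rho> a b = 0\<^sub>m m n"
    by (rule schur_inequivalent[OF irr irr' ne _ averaged_unit_intertwines[OF \<rho> \<sigma>]])
      (use assms in \<open>auto simp: averaged_unit_def\<close>)
  then have "averaged_unit m \<sigma> n \<rho> a b $$ (i, j) = 0" using assms by simp
  then show ?thesis using assms by (simp add: averaged_unit_def)
qed

lemma coefficients_orthogonal_same:
  assumes irr: "irreducible_unitary_rep G n \<rho>"
    and i: "i < n" and a: "a < n" and b: "b < n" and j: "j < n"
  shows "(\<Sum>x\<in>carrier G. \<rho> x $$ (i, a) * \<rho> (inv x) $$ (b, j)) =
    (if i = j \<and> a = b then of_nat (card (carrier G)) / of_nat n else 0)"
proof -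
  have \<rho>: "unitary_rep G n \<rho>" and n: "n > 0" using irr by (auto simp: irreducible_unitary_rep_def)
  let ?T = "averaged_unit n \<rho> n \<rho> a b"
  have "\<exists>c. ?T = c \<cdot>\<^sub>m 1\<^sub>m n"
    by (rule schur_commutant[OF irr _ averaged_unit_intertwines[OF \<rho> \<rho> a b]])
      (auto simp: averaged_unit_def)
  then obtain c where c: "?T = c \<cdot>\<^sub>m 1\<^sub>m n" by blast
  have entry: "(\<Sum>x\<in>carrier G. \<rho> x $$ (i, a) * \<rho> (inv x) $$ (b, j)) = (if i = j then c else 0)"
    if "i < n" "j < n" for i j
  proof -
    have "?T $$ (i, j) = (c \<cdot>\<^sub>m 1\<^sub>m n) $$ (i, j)" using c by simp
    then show ?thesis using that by (simp add: averaged_unit_def)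
  qed
  \<comment> \<open>The scalar \<open>c\<close> is found by taking traces.\<close>
  have "of_nat n * c = (\<Sum>i<n. \<Sum>x\<in>carrier G. \<rho> x $$ (i, a) * \<rho> (inv x) $$ (b, i))"
    using entry by simp
  also have "\<dots> = (\<Sum>x\<in>carrier G. \<Sum>i<n. \<rho> (inv x) $$ (b, i) * \<rho> x $$ (i, a))"
    by (subst sum.swap) (simp add: mult.commute)
  also have "\<dots> = (\<Sum>x\<in>carrier G. \<rho> (inv x \<otimes> x) $$ (b, a))"
    by (intro sum.cong unitary_rep_mult_index[OF \<rho> _ _ b a, symmetric]) auto
  also have "\<dots> = (\<Sum>x\<in>carrier G. if a = b then 1 else 0)"
    using unitary_rep_one[OF \<rho>] a b by (intro sum.cong) auto
  finally have "c = (if a = b then of_nat (card (carrier G)) / of_nat n else 0)"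
    using n by (auto simp: field_simps split: if_splits)
  then show ?thesis using entry[OF i j] by simp
qed

section \<open>Convolution operators on $L^2(G)$\<close>

lemma l2_norm_squared:
  "(l2_norm G f)\<^sup>2 = (\<Sum>x\<in>carrier G. (cmod (f x))\<^sup>2) / card (carrier G)"
proof -
  have "l2_inner G f f = of_real ((\<Sum>x\<in>carrier G. (cmod (f x))\<^sup>2) / card (carrier G))"
    by (simp add: l2_inner_def complex_norm_square[symmetric] del: of_real_power)
  then show ?thesis
    by (simp add: l2_norm_def sum_nonneg del: of_real_divide of_real_sum)
qed

lemma l2_inner_self: "l2_inner G f f = of_real ((l2_norm G f)\<^sup>2)"
  by (simp add: l2_norm_squared l2_inner_def complex_norm_square[symmetric] del: of_real_power)

lemma l2_inner_cong:
  assumes "\<And>x. x \<in> carrier G \<Longrightarrow> f x = f' x" "\<And>x. x \<in> carrier G \<Longrightarrow> h x = h' x"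
  shows "l2_inner G f h = l2_inner G f' h'"
  unfolding l2_inner_def using assms by (metis (mono_tags, lifting) sum.cong)

lemma l2_norm_cong:
  assumes "\<And>x. x \<in> carrier G \<Longrightarrow> f x = f' x"
  shows "l2_norm G f = l2_norm G f'"
  unfolding l2_norm_def using l2_inner_cong[of f f' f f'] assms by simp

lemma l2_norm_left_translate:
  assumes "g \<in> carrier G"
  shows "(l2_norm G (left_translate G g f))\<^sup>2 = (l2_norm G f)\<^sup>2"
proof -
  have "(\<Sum>x\<in>carrier G. (cmod (f (inv g \<otimes> x)))\<^sup>2) = (\<Sum>x\<in>carrier G. (cmod (f x))\<^sup>2)"
    by (rule sum.reindex_bij_witness[of _ "\<lambda>x. g \<otimes> x" "\<lambda>x. inv g \<otimes> x"])
      (use assms in \<open>auto simp: m_assoc[symmetric]\<close>)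
  then show ?thesis by (simp add: l2_norm_squared left_translate_def)
qed

lemma l2_norm_right_translate:
  assumes "g \<in> carrier G"
  shows "(l2_norm G (right_translate G g f))\<^sup>2 = (l2_norm G f)\<^sup>2"
proof -
  have "(\<Sum>x\<in>carrier G. (cmod (f (x \<otimes> g)))\<^sup>2) = (\<Sum>x\<in>carrier G. (cmod (f x))\<^sup>2)"
    by (rule sum.reindex_bij_witness[of _ "\<lambda>x. x \<otimes> inv g" "\<lambda>x. x \<otimes> g"])
      (use assms in \<open>auto simp: m_assoc\<close>)
  then show ?thesis by (simp add: l2_norm_squared right_translate_def)
qed

lemma l2_norm_diff_le:
  "(l2_norm G (\<lambda>x. f x - h x))\<^sup>2 \<le> 2 * (l2_norm G f)\<^sup>2 + 2 * (l2_norm G h)\<^sup>2"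
proof -
  have *: "(cmod (a - b))\<^sup>2 \<le> 2 * (cmod a)\<^sup>2 + 2 * (cmod b)\<^sup>2" for a b
  proof -
    have "(cmod (a - b))\<^sup>2 \<le> (cmod a + cmod b)\<^sup>2"
      by (intro power_mono norm_triangle_ineq4) simp
    also have "\<dots> \<le> 2 * (cmod a)\<^sup>2 + 2 * (cmod b)\<^sup>2"
      using zero_le_power2[of "cmod a - cmod b"] by (simp add: power2_eq_square algebra_simps)
    finally show ?thesis .
  qed
  have "(\<Sum>x\<in>carrier G. (cmod (f x - h x))\<^sup>2)
      \<le> (\<Sum>x\<in>carrier G. 2 * (cmod (f x))\<^sup>2 + 2 * (cmod (h x))\<^sup>2)"
    by (intro sum_mono *)
  then have "(l2_norm G (\<lambda>x. f x - h x))\<^sup>2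
      \<le> (\<Sum>x\<in>carrier G. 2 * (cmod (f x))\<^sup>2 + 2 * (cmod (h x))\<^sup>2) / card (carrier G)"
    unfolding l2_norm_squared by (rule divide_right_mono) simp
  then show ?thesis
    by (simp add: l2_norm_squared sum.distrib sum_distrib_left add_divide_distrib)
qed

lemma conv_cong_left:
  assumes "\<And>x. x \<in> carrier G \<Longrightarrow> h x = h' x"
  shows "conv G h f x = conv G h' f x"
  unfolding conv_def using assms by (metis (mono_tags, lifting) sum.cong)

lemma conv_sum_left:
  "conv G (\<lambda>x. \<Sum>r\<in>I. c r * e r x) f x = (\<Sum>r\<in>I. c r * conv G (e r) f x)"
proof -
  have "(\<Sum>y\<in>carrier G. (\<Sum>r\<in>I. c r * e r y) * f (inv y \<otimes> x))
      = (\<Sum>r\<in>I. \<Sum>y\<in>carrier G. c r * (e r y * f (inv y \<otimes> x)))"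
    by (subst sum.swap) (simp add: sum_distrib_right mult.assoc)
  then show ?thesis
    by (simp add: conv_def sum_divide_distrib[symmetric] sum_distrib_left)
qed

lemma conv_diff_right:
  "conv G h (\<lambda>x. f x - f' x) x = conv G h f x - conv G h f' x"
  by (simp add: conv_def right_diff_distrib sum_subtractf diff_divide_distrib)

lemma conv_reindex:
  assumes x: "x \<in> carrier G"
  shows "conv G h f x = (\<Sum>z\<in>carrier G. h (x \<otimes> inv z) * f z) / of_nat (card (carrier G))"
proof -
  \<comment> \<open>substitution \<open>z = inv y \<otimes> x\<close>\<close>
  have "(\<Sum>y\<in>carrier G. h y * f (inv y \<otimes> x)) = (\<Sum>z\<in>carrier G. h (x \<otimes> inv z) * f z)"
    by (rule sum.reindex_bij_witness[of _ "\<lambda>z. x \<otimes> inv z" "\<lambda>y. inv y \<otimes> x"])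
      (use x in \<open>auto simp: inv_mult_group m_assoc m_assoc[symmetric, of x "inv x"]\<close>)
  then show ?thesis by (simp add: conv_def)
qed

lemma conv_assoc:
  assumes x: "x \<in> carrier G"
  shows "conv G (conv G e h) f x = conv G e (conv G h f) x"
proof -
  have "(\<Sum>w\<in>carrier G. (\<Sum>y\<in>carrier G. e y * h (inv y \<otimes> w)) * f (inv w \<otimes> x))
      = (\<Sum>y\<in>carrier G. e y * (\<Sum>w\<in>carrier G. h (inv y \<otimes> w) * f (inv w \<otimes> x)))"
    by (simp add: sum_distrib_right sum_distrib_left mult.assoc) (rule sum.swap)
  also have "\<dots> = (\<Sum>y\<in>carrier G. e y * (\<Sum>z\<in>carrier G. h z * f (inv z \<otimes> (inv y \<otimes> x))))"
  proof (rule sum.cong[OF refl])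
    fix y assume y: "y \<in> carrier G"
    have "(\<Sum>w\<in>carrier G. h (inv y \<otimes> w) * f (inv w \<otimes> x))
        = (\<Sum>z\<in>carrier G. h (inv y \<otimes> (y \<otimes> z)) * f (inv (y \<otimes> z) \<otimes> x))"
      by (rule sum_left_mult[OF y, symmetric])
    also have "\<dots> = (\<Sum>z\<in>carrier G. h z * f (inv z \<otimes> (inv y \<otimes> x)))"
      using x y by (intro sum.cong) (auto simp: inv_mult_group m_assoc m_assoc[symmetric, of "inv y" y])
    finally show "e y * (\<Sum>w\<in>carrier G. h (inv y \<otimes> w) * f (inv w \<otimes> x)) =
        e y * (\<Sum>z\<in>carrier G. h z * f (inv z \<otimes> (inv y \<otimes> x)))" by simp
  qed
  finally show ?thesis
    by (simp add: conv_def sum_divide_distrib[symmetric])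
qed

lemma conv_self_adjoint:
  assumes h: "\<And>x. x \<in> carrier G \<Longrightarrow> h (inv x) = cnj (h x)"
  shows "l2_inner G (conv G h f) f' = l2_inner G f (conv G h f')"
proof -
  let ?N = "of_nat (card (carrier G)) :: complex"
  have "(\<Sum>x\<in>carrier G. conv G h f x * cnj (f' x))
      = (\<Sum>x\<in>carrier G. \<Sum>z\<in>carrier G. h (x \<otimes> inv z) * f z * cnj (f' x) / ?N)"
    by (simp add: conv_reindex sum_distrib_right sum_divide_distrib)
  also have "\<dots> = (\<Sum>z\<in>carrier G. \<Sum>x\<in>carrier G. f z * cnj (h (z \<otimes> inv x) * f' x / ?N))"
  proof (subst sum.swap, intro sum.cong refl)
    fix x z assume xz: "x \<in> carrier G" "z \<in> carrier G"
    have "h (x \<otimes> inv z) = h (inv (z \<otimes> inv x))" using xz by (simp add: inv_mult_group)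
    also have "\<dots> = cnj (h (z \<otimes> inv x))" using xz h by simp
    finally show "h (x \<otimes> inv z) * f z * cnj (f' x) / ?N = f z * cnj (h (z \<otimes> inv x) * f' x / ?N)"
      by simp
  qed
  also have "\<dots> = (\<Sum>z\<in>carrier G. f z * cnj (conv G h f' z))"
    by (simp add: conv_reindex sum_distrib_left sum_divide_distrib)
  finally show ?thesis by (simp add: l2_inner_def)
qed

lemma l2_inner_sum:
  "l2_inner G (\<lambda>x. \<Sum>r\<in>I. c r * u r x) (\<lambda>x. \<Sum>s\<in>I. b s * v s x)
    = (\<Sum>r\<in>I. \<Sum>s\<in>I. c r * cnj (b s) * l2_inner G (u r) (v s))"
proof -
  have "(\<Sum>x\<in>carrier G. (\<Sum>r\<in>I. c r * u r x) * cnj (\<Sum>s\<in>I. b s * v s x))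
      = (\<Sum>x\<in>carrier G. \<Sum>r\<in>I. \<Sum>s\<in>I. c r * cnj (b s) * (u r x * cnj (v s x)))"
    by (simp add: sum_product mult_ac)
  also have "\<dots> = (\<Sum>r\<in>I. \<Sum>x\<in>carrier G. \<Sum>s\<in>I. c r * cnj (b s) * (u r x * cnj (v s x)))"
    by (rule sum.swap)
  also have "\<dots> = (\<Sum>r\<in>I. \<Sum>s\<in>I. \<Sum>x\<in>carrier G. c r * cnj (b s) * (u r x * cnj (v s x)))"
    by (intro sum.cong refl sum.swap)
  finally show ?thesis
    by (simp add: l2_inner_def sum_distrib_left sum_divide_distrib)
qed

text \<open>Conditions on a finite family of functions which make the operators \<open>conv G (e r)\<close> mutually
  orthogonal self-adjoint projections of $L^2(G)$. The middle condition gives self-adjointness,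
  the last one idempotence and orthogonality.\<close>

definition orthogonal_idempotents :: "nat set \<Rightarrow> (nat \<Rightarrow> 'a \<Rightarrow> complex) \<Rightarrow> bool" where
  "orthogonal_idempotents I e \<longleftrightarrow> finite I \<and>
     (\<forall>r\<in>I. \<forall>x\<in>carrier G. e r (inv x) = cnj (e r x)) \<and>
     (\<forall>r\<in>I. \<forall>s\<in>I. \<forall>x\<in>carrier G. conv G (e r) (e s) x = (if r = s then e r x else 0))"

lemma projections_inner:
  assumes e: "orthogonal_idempotents I e" and r: "r \<in> I" and s: "s \<in> I"
  shows "l2_inner G (conv G (e r) f) (conv G (e s) f)
    = (if r = s then l2_inner G f (conv G (e r) f) else 0)"
proof -
  have "l2_inner G (conv G (e r) f) (conv G (e s) f)
      = l2_inner G f (conv G (e r) (conv G (e s) f))"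
    by (rule conv_self_adjoint) (use e r in \<open>auto simp: orthogonal_idempotents_def\<close>)
  also have "\<dots> = l2_inner G f (conv G (conv G (e r) (e s)) f)"
    by (intro l2_inner_cong) (simp_all add: conv_assoc)
  also have "\<dots> = l2_inner G f (conv G (\<lambda>x. if r = s then e r x else 0) f)"
    by (intro l2_inner_cong conv_cong_left) (use e r s in \<open>auto simp: orthogonal_idempotents_def\<close>)
  also have "\<dots> = (if r = s then l2_inner G f (conv G (e r) f) else 0)"
    by (auto simp: conv_def l2_inner_def)
  finally show ?thesis .
qed

lemma norm_conv_combination:
  assumes e: "orthogonal_idempotents I e"
  shows "(l2_norm G (conv G (\<lambda>x. \<Sum>r\<in>I. c r * e r x) f))\<^sup>2
    = (\<Sum>r\<in>I. (cmod (c r))\<^sup>2 * (l2_norm G (conv G (e r) f))\<^sup>2)"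
proof -
  have fin: "finite I" using e by (simp add: orthogonal_idempotents_def)
  have "complex_of_real ((l2_norm G (conv G (\<lambda>x. \<Sum>r\<in>I. c r * e r x) f))\<^sup>2)
      = (\<Sum>r\<in>I. \<Sum>s\<in>I. c r * cnj (c s) * l2_inner G (conv G (e r) f) (conv G (e s) f))"
    unfolding l2_inner_self[symmetric] l2_inner_sum[symmetric]
    by (intro l2_inner_cong) (simp_all add: conv_sum_left)
  also have "\<dots> = (\<Sum>r\<in>I. \<Sum>s\<in>I. if s = r then c r * cnj (c r) * l2_inner G (conv G (e r) f) (conv G (e r) f) else 0)"
    using e by (intro sum.cong refl) (auto simp: projections_inner)
  also have "\<dots> = (\<Sum>r\<in>I. c r * cnj (c r) * l2_inner G (conv G (e r) f) (conv G (e r) f))"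
    using fin by simp
  also have "\<dots> = complex_of_real (\<Sum>r\<in>I. (cmod (c r))\<^sup>2 * (l2_norm G (conv G (e r) f))\<^sup>2)"
    by (simp add: l2_inner_self complex_norm_square[symmetric])
  finally show ?thesis by (simp only: of_real_eq_iff)
qed

text \<open>Bessel's inequality for the projections.\<close>

lemma projections_bessel:
  assumes e: "orthogonal_idempotents I e"
  shows "(\<Sum>r\<in>I. (l2_norm G (conv G (e r) f))\<^sup>2) \<le> (l2_norm G f)\<^sup>2"
proof -
  define P where "P x = (\<Sum>r\<in>I. conv G (e r) f x)" for x
  define b where "b = (\<Sum>r\<in>I. (l2_norm G (conv G (e r) f))\<^sup>2)"
  have "(l2_norm G (conv G (\<lambda>x. \<Sum>r\<in>I. 1 * e r x) f))\<^sup>2 = b"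
    using norm_conv_combination[OF e, of "\<lambda>_. 1" f] by (simp add: b_def)
  moreover have "conv G (\<lambda>x. \<Sum>r\<in>I. 1 * e r x) f = P"
    unfolding fun_eq_iff conv_sum_left P_def by simp
  ultimately have PP: "l2_inner G P P = of_real b"
    unfolding l2_inner_self by metis
  have "l2_inner G f P = (\<Sum>r\<in>I. l2_inner G f (conv G (e r) f))"
    by (simp add: l2_inner_def P_def sum_distrib_left sum_divide_distrib) (rule sum.swap)
  also have "\<dots> = (\<Sum>r\<in>I. l2_inner G (conv G (e r) f) (conv G (e r) f))"
    using projections_inner[OF e] by simp
  also have "\<dots> = of_real b" by (simp add: l2_inner_self b_def)
  finally have fP: "l2_inner G f P = of_real b" .
  have "l2_inner G P f = cnj (l2_inner G f P)" by (simp add: l2_inner_def mult.commute)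
  then have Pf: "l2_inner G P f = of_real b" using fP by simp
  have "l2_inner G (\<lambda>x. f x - P x) (\<lambda>x. f x - P x)
      = l2_inner G f f - l2_inner G f P - l2_inner G P f + l2_inner G P P"
    by (simp add: l2_inner_def algebra_simps sum.distrib sum_subtractf diff_divide_distrib add_divide_distrib)
  also have "\<dots> = of_real ((l2_norm G f)\<^sup>2 - b)" unfolding fP Pf PP l2_inner_self[of f] by simp
  finally have "(l2_norm G (\<lambda>x. f x - P x))\<^sup>2 = (l2_norm G f)\<^sup>2 - b"
    unfolding l2_inner_self by (simp only: of_real_eq_iff)
  then show ?thesis using zero_le_power2[of "l2_norm G (\<lambda>x. f x - P x)"] by (simp add: b_def)
qed

section \<open>Convolution of irreducible characters\<close>

lemma character_conv_expand:
  assumes \<rho>: "unitary_rep G n \<rho>" and \<sigma>: "unitary_rep G m \<sigma>" and x: "x \<in> carrier G"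
  shows "conv G (rep_character \<sigma>) (rep_character \<rho>) x =
    (\<Sum>i<m. \<Sum>b<n. \<Sum>c<n. \<rho> x $$ (c, b) *
       (\<Sum>y\<in>carrier G. \<sigma> y $$ (i, i) * \<rho> (inv y) $$ (b, c))) / of_nat (card (carrier G))"
proof -
  have "(\<Sum>y\<in>carrier G. rep_character \<sigma> y * rep_character \<rho> (inv y \<otimes> x))
      = (\<Sum>y\<in>carrier G. (\<Sum>i<m. \<sigma> y $$ (i, i)) * (\<Sum>b<n. \<Sum>c<n. \<rho> (inv y) $$ (b, c) * \<rho> x $$ (c, b)))"
    using x by (intro sum.cong) (auto simp: character_eq_sum[OF \<sigma>] character_eq_sum[OF \<rho>]
        unitary_rep_mult_index[OF \<rho>])
  also have "\<dots> = (\<Sum>y\<in>carrier G. \<Sum>i<m. \<Sum>b<n. \<Sum>c<n.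
      \<rho> x $$ (c, b) * (\<sigma> y $$ (i, i) * \<rho> (inv y) $$ (b, c)))"
    unfolding sum_distrib_right by (simp add: sum_distrib_left mult_ac)
  also have "\<dots> = (\<Sum>i<m. \<Sum>y\<in>carrier G. \<Sum>b<n. \<Sum>c<n.
      \<rho> x $$ (c, b) * (\<sigma> y $$ (i, i) * \<rho> (inv y) $$ (b, c)))"
    by (rule sum.swap)
  also have "\<dots> = (\<Sum>i<m. \<Sum>b<n. \<Sum>y\<in>carrier G. \<Sum>c<n.
      \<rho> x $$ (c, b) * (\<sigma> y $$ (i, i) * \<rho> (inv y) $$ (b, c)))"
    by (intro sum.cong refl sum.swap)
  also have "\<dots> = (\<Sum>i<m. \<Sum>b<n. \<Sum>c<n. \<Sum>y\<in>carrier G.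
      \<rho> x $$ (c, b) * (\<sigma> y $$ (i, i) * \<rho> (inv y) $$ (b, c)))"
    by (intro sum.cong refl sum.swap)
  finally show ?thesis by (simp add: conv_def sum_distrib_left)
qed

lemma character_conv_inequivalent:
  assumes irr: "irreducible_unitary_rep G n \<rho>" and irr': "irreducible_unitary_rep G m \<sigma>"
    and ne: "\<not> equivalent_reps G n \<rho> m \<sigma>" and x: "x \<in> carrier G"
  shows "conv G (rep_character \<sigma>) (rep_character \<rho>) x = 0"
proof -
  have \<rho>: "unitary_rep G n \<rho>" and \<sigma>: "unitary_rep G m \<sigma>"
    using irr irr' by (auto simp: irreducible_unitary_rep_def)
  show ?thesis
    unfolding character_conv_expand[OF \<rho> \<sigma> x]
    by (simp add: coefficients_orthogonal_inequivalent[OF irr irr' ne])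
qed

lemma character_conv_same:
  assumes irr: "irreducible_unitary_rep G n \<rho>" and x: "x \<in> carrier G"
  shows "conv G (rep_character \<rho>) (rep_character \<rho>) x = rep_character \<rho> x / of_nat n"
proof -
  let ?N = "of_nat (card (carrier G)) :: complex"
  have \<rho>: "unitary_rep G n \<rho>" and n: "n > 0"
    using irr by (auto simp: irreducible_unitary_rep_def)
  have "conv G (rep_character \<rho>) (rep_character \<rho>) x =
    (\<Sum>i<n. \<Sum>b<n. \<Sum>c<n. \<rho> x $$ (c, b) * (if i = c \<and> i = b then ?N / of_nat n else 0)) / ?N"
    unfolding character_conv_expand[OF \<rho> \<rho> x]
    by (simp add: coefficients_orthogonal_same[OF irr])
  also have "\<dots> = (\<Sum>i<n. \<Sum>b<n. if b = i then \<rho> x $$ (i, i) * (?N / of_nat n) else 0) / ?N"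
  proof (intro arg_cong2[of _ _ _ _ "(/)"] sum.cong refl)
    fix i b assume i: "i \<in> {..<n}"
    have "(\<Sum>c<n. \<rho> x $$ (c, b) * (if i = c \<and> i = b then ?N / of_nat n else 0))
        = (\<Sum>c<n. if c = i then (if b = i then \<rho> x $$ (i, i) * (?N / of_nat n) else 0) else 0)"
      by (intro sum.cong) auto
    then show "(\<Sum>c<n. \<rho> x $$ (c, b) * (if i = c \<and> i = b then ?N / of_nat n else 0))
        = (if b = i then \<rho> x $$ (i, i) * (?N / of_nat n) else 0)"
      using i by simp
  qed
  also have "\<dots> = (\<Sum>i<n. \<rho> x $$ (i, i)) / of_nat n"
    using card_carrier_pos by (simp add: sum_divide_distrib)
  finally show ?thesis by (simp add: character_eq_sum[OF \<rho> x])
qed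

lemma conv_scale: "conv G (\<lambda>x. a * h x) (\<lambda>x. b * f x) x = a * b * conv G h f x"
  by (simp add: conv_def sum_distrib_left mult_ac)

lemma characters_orthogonal_idempotents:
  assumes sys: "complete_irrep_system G k d \<pi>"
  shows "orthogonal_idempotents {1..k} (\<lambda>r x. of_nat (d r) * rep_character (\<pi> r) x)"
  unfolding orthogonal_idempotents_def
proof (intro conjI ballI)
  have irr: "irreducible_unitary_rep G (d r) (\<pi> r)" if "r \<in> {1..k}" for r
    using sys that by (auto simp: complete_irrep_system_def)
  fix r x assume r: "r \<in> {1..k}" and x: "x \<in> carrier G"
  then have u: "unitary_rep G (d r) (\<pi> r)" and n: "d r > 0"
    using irr[OF r] by (auto simp: irreducible_unitary_rep_def)
  show "of_nat (d r) * rep_character (\<pi> r) (inv x) = cnj (of_nat (d r) * rep_character (\<pi> r) x)"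
    using character_inv[OF u x] by simp
  fix s y assume s: "s \<in> {1..k}" and y: "y \<in> carrier G"
  show "conv G (\<lambda>x. of_nat (d r) * rep_character (\<pi> r) x) (\<lambda>x. of_nat (d s) * rep_character (\<pi> s) x) y
      = (if r = s then of_nat (d r) * rep_character (\<pi> r) y else 0)"
  proof (cases "r = s")
    case True
    then show ?thesis using character_conv_same[OF irr[OF r] y] n by (simp add: conv_scale)
  next
    case False
    then have "\<not> equivalent_reps G (d s) (\<pi> s) (d r) (\<pi> r)"
      using sys r s by (auto simp: complete_irrep_system_def)
    then show ?thesis
      using character_conv_inequivalent[OF irr[OF s] irr[OF r] _ y] False by (simp add: conv_scale)
  qed
qed simp

text \<open>The trivial representation is irreducible, so a complete system is nonempty.\<close>

lemma complete_system_nonempty: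
  assumes "complete_irrep_system G k d \<pi>"
  shows "k \<ge> 1"
proof -
  let ?\<rho> = "\<lambda>x::'a. 1\<^sub>m 1 :: complex mat"
  have adj: "mat_adjoint (1\<^sub>m 1 :: complex mat) = 1\<^sub>m 1"
    using mat_adjoint_carrier[of "1\<^sub>m 1" 1 1] by (intro eq_matI) (auto simp: mat_adjoint_index[of _ 1 1])
  have "unitary_rep G 1 ?\<rho>"
    by (auto simp: unitary_rep_def hom_def unitary_group_def adj inverts_mat_def simp del: One_nat_def)
  moreover have "W = {0\<^sub>v 1} \<or> W = carrier_vec 1" if "invariant_subspace G 1 ?\<rho> W" for W
  proof -
    have sub: "submodule class_ring W (module_vec TYPE(complex) 1)"
      using that by (auto simp: invariant_subspace_def VectorSpace.subspace_def)
    have W: "W \<subseteq> carrier_vec 1" and W0: "0\<^sub>v 1 \<in> W"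
      using submodule.subset[OF sub] submodule.zero_closed[OF sub] by (auto simp: module_vec_def)
    have Ws: "a \<cdot>\<^sub>v w \<in> W" if "w \<in> W" for a w
      using submodule.smult_closed[OF sub _ that, of a] by (auto simp: module_vec_def)
    show ?thesis
    proof (cases "W = {0\<^sub>v 1}")
      case False
      then obtain w where w: "w \<in> W" "w \<noteq> 0\<^sub>v 1" using W0 by auto
      then have wc: "w \<in> carrier_vec 1" using W by auto
      then have w0: "w $ 0 \<noteq> 0" using w(2) by (auto simp: vec_eq_iff)
      have "v \<in> W" if v: "v \<in> carrier_vec 1" for v
      proof -
        have "v = (v $ 0 / w $ 0) \<cdot>\<^sub>v w"
          using v wc w0 by (intro eq_vecI) auto
        then show ?thesis using Ws[OF w(1)] by metis
      qed
      then show ?thesis using W by auto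
    qed simp
  qed
  ultimately have "irreducible_unitary_rep G 1 ?\<rho>" by (auto simp: irreducible_unitary_rep_def)
  then have "\<exists>r\<in>{1..k}. equivalent_reps G 1 ?\<rho> (d r) (\<pi> r)"
    using assms by (simp add: complete_irrep_system_def)
  then show ?thesis by auto
qed

section \<open>Energy decay along paths\<close>

lemma wavelet_eq_combination:
  "wavelet k d \<pi> \<gamma> j = (\<lambda>x. \<Sum>r\<in>{1..k}. \<gamma> j r * (of_nat (d r) * rep_character (\<pi> r) x))"
  by (simp add: wavelet_def fun_eq_iff mult_ac)

lemma lowpass_max_nonneg:
  fixes \<gamma> :: "nat \<Rightarrow> nat \<Rightarrow> complex"
  assumes sys: "complete_irrep_system G k d \<pi>"
  shows "0 \<le> Max ((\<lambda>r. (cmod (\<gamma> 0 r))\<^sup>2) ` {1..k})"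
proof -
  have "(cmod (\<gamma> 0 1))\<^sup>2 \<le> Max ((\<lambda>r. (cmod (\<gamma> 0 r))\<^sup>2) ` {1..k})"
    using complete_system_nonempty[OF sys] by (intro Max_ge) auto
  then show ?thesis using zero_le_power2[of "cmod (\<gamma> 0 1)"] by linarith
qed

lemma lowpass_bound:
  assumes sys: "complete_irrep_system G k d \<pi>"
  shows "(l2_norm G (conv G (wavelet k d \<pi> \<gamma> 0) f))\<^sup>2
    \<le> Max ((\<lambda>r. (cmod (\<gamma> 0 r))\<^sup>2) ` {1..k}) * (l2_norm G f)\<^sup>2" (is "_ \<le> ?M * _")
proof -
  note e = characters_orthogonal_idempotents[OF sys]
  let ?P = "\<lambda>r. (l2_norm G (conv G (\<lambda>x. of_nat (d r) * rep_character (\<pi> r) x) f))\<^sup>2"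
  have "(l2_norm G (conv G (wavelet k d \<pi> \<gamma> 0) f))\<^sup>2 = (\<Sum>r\<in>{1..k}. (cmod (\<gamma> 0 r))\<^sup>2 * ?P r)"
    unfolding wavelet_eq_combination by (rule norm_conv_combination[OF e])
  also have "\<dots> \<le> (\<Sum>r\<in>{1..k}. ?M * ?P r)"
    by (intro sum_mono mult_right_mono Max_ge) auto
  also have "\<dots> = ?M * (\<Sum>r\<in>{1..k}. ?P r)" by (simp add: sum_distrib_left)
  also have "\<dots> \<le> ?M * (l2_norm G f)\<^sup>2"
    by (rule mult_left_mono[OF projections_bessel[OF e] lowpass_max_nonneg[OF sys]])
  finally show ?thesis .
qed

lemma kernel_alpha_nonneg:
  assumes sys: "complete_irrep_system G k d \<pi>" and adm: "admissible_kernel k J \<gamma>"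
  shows "0 \<le> 1 - kernel_beta k \<gamma>"
proof -
  have 1: "1 \<in> {1..k}" using complete_system_nonempty[OF sys] by simp
  have "0 \<le> (\<Sum>j=1..J. (cmod (\<gamma> j 1))\<^sup>2)" by (simp add: sum_nonneg)
  also have "\<dots> = 1 - (cmod (\<gamma> 0 1))\<^sup>2" using adm 1 by (auto simp: admissible_kernel_def)
  also have "\<dots> \<le> 1 - kernel_beta k \<gamma>"
    unfolding kernel_beta_def using 1 by (auto intro!: Min_le)
  finally show ?thesis .
qed

lemma highpass_bound:
  assumes sys: "complete_irrep_system G k d \<pi>" and adm: "admissible_kernel k J \<gamma>"
  shows "(\<Sum>j=1..J. (l2_norm G (conv G (wavelet k d \<pi> \<gamma> j) f))\<^sup>2)
    \<le> (1 - kernel_beta k \<gamma>) * (l2_norm G f)\<^sup>2"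
proof -
  note e = characters_orthogonal_idempotents[OF sys]
  let ?P = "\<lambda>r. (l2_norm G (conv G (\<lambda>x. of_nat (d r) * rep_character (\<pi> r) x) f))\<^sup>2"
  have beta: "kernel_beta k \<gamma> \<le> (cmod (\<gamma> 0 r))\<^sup>2" if "r \<in> {1..k}" for r
    unfolding kernel_beta_def using that by (intro Min_le) auto
  have adm': "(\<Sum>j=1..J. (cmod (\<gamma> j r))\<^sup>2) = 1 - (cmod (\<gamma> 0 r))\<^sup>2" if "r \<in> {1..k}" for r
    using adm that by (auto simp: admissible_kernel_def)
  have "(\<Sum>j=1..J. (l2_norm G (conv G (wavelet k d \<pi> \<gamma> j) f))\<^sup>2)
      = (\<Sum>j=1..J. \<Sum>r\<in>{1..k}. (cmod (\<gamma> j r))\<^sup>2 * ?P r)"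
    unfolding wavelet_eq_combination norm_conv_combination[OF e] ..
  also have "\<dots> = (\<Sum>r\<in>{1..k}. \<Sum>j=1..J. (cmod (\<gamma> j r))\<^sup>2 * ?P r)"
    by (rule sum.swap)
  also have "\<dots> = (\<Sum>r\<in>{1..k}. (1 - (cmod (\<gamma> 0 r))\<^sup>2) * ?P r)"
    unfolding sum_distrib_right[symmetric] by (intro sum.cong refl) (simp only: adm')
  also have "\<dots> \<le> (\<Sum>r\<in>{1..k}. (1 - kernel_beta k \<gamma>) * ?P r)"
    using beta by (intro sum_mono mult_right_mono) auto
  also have "\<dots> = (1 - kernel_beta k \<gamma>) * (\<Sum>r\<in>{1..k}. ?P r)" by (simp add: sum_distrib_left)
  also have "\<dots> \<le> (1 - kernel_beta k \<gamma>) * (l2_norm G f)\<^sup>2"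
    by (rule mult_left_mono[OF projections_bessel[OF e] kernel_alpha_nonneg[OF sys adm]])
  finally show ?thesis .
qed

lemma sum_paths_Suc:
  "(\<Sum>p\<in>paths J (Suc m). F p) = (\<Sum>j=1..J. \<Sum>p\<in>paths J m. F (j # p))"
proof -
  have "(\<Sum>p\<in>paths J (Suc m). F p) = (\<Sum>(j, p)\<in>{1..J} \<times> paths J m. F (j # p))"
    by (rule sum.reindex_bij_witness[of _ "\<lambda>(j, p). j # p" "\<lambda>p. (hd p, tl p)"])
      (auto simp: paths_def length_Suc_conv)
  then show ?thesis by (simp add: sum.cartesian_product)
qed

text \<open>The modulus preserves the norm, so every further layer costs one factor from
  \<open>highpass_bound\<close>.\<close>

lemma propagator_energy_decay:
  assumes sys: "complete_irrep_system G k d \<pi>" and adm: "admissible_kernel k J \<gamma>"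
  shows "(\<Sum>p\<in>paths J m. (l2_norm G (scatter_propagator G (wavelet k d \<pi> \<gamma>) p f))\<^sup>2)
    \<le> (1 - kernel_beta k \<gamma>) ^ m * (l2_norm G f)\<^sup>2"
proof (induction m arbitrary: f)
  case 0
  have "paths J 0 = {[]}" by (auto simp: paths_def)
  then show ?case by (simp add: scatter_propagator_def)
next
  case (Suc m)
  let ?\<psi> = "wavelet k d \<pi> \<gamma>" and ?\<alpha> = "1 - kernel_beta k \<gamma>"
  have "0 \<le> ?\<alpha>" by (rule kernel_alpha_nonneg[OF sys adm])
  have step: "(l2_norm G (scatter_step G \<psi> j f))\<^sup>2 = (l2_norm G (conv G (\<psi> j) f))\<^sup>2" for \<psi> j
    by (simp add: l2_norm_squared scatter_step_def)
  have "(\<Sum>p\<in>paths J (Suc m). (l2_norm G (scatter_propagator G ?\<psi> p f))\<^sup>2)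
      = (\<Sum>j=1..J. \<Sum>p\<in>paths J m. (l2_norm G (scatter_propagator G ?\<psi> p (scatter_step G ?\<psi> j f)))\<^sup>2)"
    by (simp add: sum_paths_Suc scatter_propagator_def)
  also have "\<dots> \<le> (\<Sum>j=1..J. ?\<alpha> ^ m * (l2_norm G (conv G (?\<psi> j) f))\<^sup>2)"
    unfolding step[symmetric] by (intro sum_mono Suc.IH)
  also have "\<dots> = ?\<alpha> ^ m * (\<Sum>j=1..J. (l2_norm G (conv G (?\<psi> j) f))\<^sup>2)"
    by (simp add: sum_distrib_left)
  also have "\<dots> \<le> ?\<alpha> ^ m * (?\<alpha> * (l2_norm G f)\<^sup>2)"
    using \<open>0 \<le> ?\<alpha>\<close> by (intro mult_left_mono highpass_bound[OF sys adm]) simp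
  finally show ?case by (simp add: mult_ac)
qed

text \<open>No relation between \<open>f\<close> and \<open>h\<close> beyond equality of norms enters: the energies of their
  propagated functions are bounded separately.\<close>

lemma scattering_difference_bound:
  assumes sys: "complete_irrep_system G k d \<pi>" and adm: "admissible_kernel k J \<gamma>"
    and norm: "(l2_norm G h)\<^sup>2 = (l2_norm G f)\<^sup>2"
  shows "(\<Sum>p\<in>paths J m. (l2_norm G (\<lambda>x. scattering G (wavelet k d \<pi> \<gamma>) p h x
            - scattering G (wavelet k d \<pi> \<gamma>) p f x))\<^sup>2)
    \<le> Max ((\<lambda>r. (cmod (\<gamma> 0 r))\<^sup>2) ` {1..k}) * 4 * (1 - kernel_beta k \<gamma>) ^ m * (l2_norm G f)\<^sup>2"
proof -
  let ?\<psi> = "wavelet k d \<pi> \<gamma>" and ?\<alpha> = "1 - kernel_beta k \<gamma>"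
  let ?U = "scatter_propagator G ?\<psi>"
  define M where "M = Max ((\<lambda>r. (cmod (\<gamma> 0 r))\<^sup>2) ` {1..k})"
  have M0: "0 \<le> M" unfolding M_def by (rule lowpass_max_nonneg[OF sys])
  have "(\<Sum>p\<in>paths J m. (l2_norm G (\<lambda>x. scattering G ?\<psi> p h x - scattering G ?\<psi> p f x))\<^sup>2)
      \<le> (\<Sum>p\<in>paths J m. M * (2 * (l2_norm G (?U p h))\<^sup>2 + 2 * (l2_norm G (?U p f))\<^sup>2))"
  proof (rule sum_mono)
    fix p
    have "(l2_norm G (\<lambda>x. scattering G ?\<psi> p h x - scattering G ?\<psi> p f x))\<^sup>2
        = (l2_norm G (conv G (?\<psi> 0) (\<lambda>x. ?U p h x - ?U p f x)))\<^sup>2"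
      by (simp add: scattering_def conv_diff_right cong: l2_norm_cong)
    also have "\<dots> \<le> M * (l2_norm G (\<lambda>x. ?U p h x - ?U p f x))\<^sup>2"
      unfolding M_def by (rule lowpass_bound[OF sys])
    also have "\<dots> \<le> M * (2 * (l2_norm G (?U p h))\<^sup>2 + 2 * (l2_norm G (?U p f))\<^sup>2)"
      by (intro mult_left_mono l2_norm_diff_le M0)
    finally show "(l2_norm G (\<lambda>x. scattering G ?\<psi> p h x - scattering G ?\<psi> p f x))\<^sup>2
        \<le> M * (2 * (l2_norm G (?U p h))\<^sup>2 + 2 * (l2_norm G (?U p f))\<^sup>2)" .
  qed
  also have "\<dots> = M * (2 * (\<Sum>p\<in>paths J m. (l2_norm G (?U p h))\<^sup>2)
      + 2 * (\<Sum>p\<in>paths J m. (l2_norm G (?U p f))\<^sup>2))"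
    by (simp add: sum_distrib_left[symmetric] sum.distrib)
  also have "\<dots> \<le> M * (2 * (?\<alpha> ^ m * (l2_norm G h)\<^sup>2) + 2 * (?\<alpha> ^ m * (l2_norm G f)\<^sup>2))"
    by (intro mult_left_mono add_mono propagator_energy_decay[OF sys adm] M0) auto
  also have "\<dots> = M * 4 * ?\<alpha> ^ m * (l2_norm G f)\<^sup>2" by (simp add: norm)
  finally show ?thesis unfolding M_def .
qed

end

theorem theorem4p8:
  fixes G :: "('a, 'b) monoid_scheme"
    and k J m :: nat
    and d :: "nat \<Rightarrow> nat"
    and \<pi> :: "nat \<Rightarrow> 'a \<Rightarrow> complex mat"
    and \<gamma> :: "nat \<Rightarrow> nat \<Rightarrow> complex"
    and \<psi> :: "nat \<Rightarrow> 'a \<Rightarrow> complex"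
    and \<alpha> :: real
    and f :: "'a \<Rightarrow> complex"
    and g :: 'a
  assumes "group G"
    and "finite (carrier G)"
    and "complete_irrep_system G k d \<pi>"
    and "J \<ge> 1"
    and "admissible_kernel k J \<gamma>"
    and "\<psi> = wavelet k d \<pi> \<gamma>"
    and "\<alpha> = 1 - kernel_beta k \<gamma>"
    and "m \<ge> 1"
    and "g \<in> carrier G"
  shows "(\<Sum>p\<in>paths J m.
            (l2_norm G (\<lambda>x. scattering G \<psi> p (left_translate G g f) x - scattering G \<psi> p f x))\<^sup>2)
          \<le> Max ((\<lambda>r. (cmod (\<gamma> 0 r))\<^sup>2) ` {1..k}) * 4 * \<alpha> ^ m * (l2_norm G f)\<^sup>2 \<and>
         (\<Sum>p\<in>paths J m.
            (l2_norm G (\<lambda>x. scattering G \<psi> p (right_translate G g f) x - scattering G \<psi> p f x))\<^sup>2)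
          \<le> Max ((\<lambda>r. (cmod (\<gamma> 0 r))\<^sup>2) ` {1..k}) * 4 * \<alpha> ^ m * (l2_norm G f)\<^sup>2"
proof -
  interpret finite_group G
    using assms(1,2) by (simp add: finite_group_def finite_group_axioms_def)
  show ?thesis
    unfolding assms(6,7)
    by (intro conjI scattering_difference_bound assms l2_norm_left_translate l2_norm_right_translate)
qed

end
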